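(* Let $r\ge 0$ be an integer. For each $p\in V_r^2(T^{\rm ps})$ there exists $v\in L_{r+1}^1(T^{\rm ps})$ such that $\operatorname{div} v=p$.
   Context: Let $T\subset\mathbb R^2$ be a (closed, nondegenerate) triangle with vertices $z_1,z_2,z_3$, labelled counter-clockwise, and let $z_0$ be a point in the interior of $T$. Let $e_i=[z_{i+1},z_{i+2}]$ (indices $1,2,3$ modulo $3$) be the edge of $T$ opposite $z_i$, and let $z_{3+i}$ be a point in the relative interior of $e_i$, $i=1,2,3$. The Powell--Sabin split $T^{\rm ps}=\{T_1,\dots,T_6\}$ is the triangulation of $T$ obtained by connecting $z_0$ to each of $z_1,\dots,z_6$. $\mathcal P_r(S)$ is the space of polynomials of degree $\le r$ on $S$, and $V_r^2(T^{\rm ps})=\mathcal P_r(T^{\rm ps})=\{q\in L^2(T): q|_S\in\mathcal P_r(S)\ \forall S\in T^{\rm ps}\}$. $L_r^1(T^{\rm ps})=[\mathcal P_r(T^{\rm ps})\cap C(T)]^2$ is the space of continuous piecewise polynomial vector fields of degree $\le r$. *)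

theory Defs
  imports "HOL-Analysis.Analysis"
begin

text \<open>
  The points of a Powell--Sabin split are a family \<open>z :: nat \<Rightarrow> real^2\<close> of which only
  \<open>z 0, \<dots>, z 6\<close> matter.  For \<open>i \<in> {1,2,3}\<close> the cyclic successors \<open>i+1\<close> and \<open>i+2\<close>
  (indices \<open>1,2,3\<close> modulo \<open>3\<close>) are \<open>i mod 3 + 1\<close> and \<open>(i + 1) mod 3 + 1\<close>.
\<close>

definition ps_triangle :: "(nat \<Rightarrow> real^2) \<Rightarrow> (real^2) set" where
  "ps_triangle z = convex hull {z 1, z 2, z 3}"

definition ps_edge :: "(nat \<Rightarrow> real^2) \<Rightarrow> nat \<Rightarrow> (real^2) set" where
  "ps_edge z i = closed_segment (z (i mod 3 + 1)) (z ((i + 1) mod 3 + 1))"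

text \<open>Positivity of the determinant says that the triangle is nondegenerate and that its
  vertices are labelled counter-clockwise.\<close>

definition powell_sabin :: "(nat \<Rightarrow> real^2) \<Rightarrow> bool" where
  "powell_sabin z \<longleftrightarrow>
     0 < det (vector [z 2 - z 1, z 3 - z 1] :: real^2^2) \<and>
     z 0 \<in> interior (ps_triangle z) \<and>
     (\<forall>i\<in>{1,2,3}. z (3 + i) \<in> rel_interior (ps_edge z i))"

definition ps_split :: "(nat \<Rightarrow> real^2) \<Rightarrow> (real^2) set set" where
  "ps_split z =
     (\<Union>i\<in>{1,2,3}. {convex hull {z 0, z (i mod 3 + 1), z (3 + i)},
                   convex hull {z 0, z (3 + i), z ((i + 1) mod 3 + 1)}})"

definition poly_deg_le :: "nat \<Rightarrow> (real^2 \<Rightarrow> real) set" where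
  "poly_deg_le r =
     {q. \<exists>c. \<forall>x. q x = (\<Sum>i\<le>r. \<Sum>j\<le>r - i. c i j * (x $ 1) ^ i * (x $ 2) ^ j)}"

text \<open>Elements of \<open>L\<^sup>2\<close> are represented by functions, of which only the values almost
  everywhere on the given set are relevant.\<close>

definition square_integrable_on :: "(real^2) set \<Rightarrow> (real^2 \<Rightarrow> real) set" where
  "square_integrable_on T =
     {q. q \<in> borel_measurable (lebesgue_on T) \<and> integrable (lebesgue_on T) (\<lambda>x. (q x)\<^sup>2)}"

text \<open>The space \<open>P\<^sub>r(T\<^sup>p\<^sup>s) = V\<^sup>2\<^sub>r(T\<^sup>p\<^sup>s)\<close>.\<close>

definition pw_poly :: "nat \<Rightarrow> (nat \<Rightarrow> real^2) \<Rightarrow> (real^2 \<Rightarrow> real) set" where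
  "pw_poly r z =
     {q \<in> square_integrable_on (ps_triangle z).
        \<forall>S\<in>ps_split z. \<exists>g\<in>poly_deg_le r. AE x in lebesgue_on S. q x = g x}"

text \<open>The space \<open>L\<^sup>1\<^sub>r(T\<^sup>p\<^sup>s) = [P\<^sub>r(T\<^sup>p\<^sup>s) \<inter> C(T)]\<^sup>2\<close>.\<close>

definition lagrange_field :: "nat \<Rightarrow> (nat \<Rightarrow> real^2) \<Rightarrow> (real^2 \<Rightarrow> real^2) set" where
  "lagrange_field r z =
     {v. \<forall>k. (\<lambda>x. v x $ k) \<in> pw_poly r z \<and> continuous_on (ps_triangle z) (\<lambda>x. v x $ k)}"

text \<open>The field \<open>v\<close> is differentiable almost everywhere on \<open>T\<close>, and its divergence agrees
  with \<open>p\<close> there.  For the continuous piecewise polynomial fields to which this is applied,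
  the almost everywhere divergence is also the divergence in the sense of distributions.\<close>

definition has_divergence_on ::
    "(real^2 \<Rightarrow> real^2) \<Rightarrow> (real^2 \<Rightarrow> real) \<Rightarrow> (real^2) set \<Rightarrow> bool" where
  "has_divergence_on v p T \<longleftrightarrow>
     (AE x in lebesgue_on T. \<exists>D. (v has_derivative D) (at x) \<and> trace (matrix D) = p x)"

end

theory Submission
  imports Defs
begin

text \<open>
  The three triangles with vertices \<open>z\<^sub>0\<close>, \<open>z\<^sub>i\<^sub>+\<^sub>1\<close>, \<open>z\<^sub>i\<^sub>+\<^sub>2\<close>, each split in two by \<open>z\<^sub>3\<^sub>+\<^sub>i\<close>, can be treated
  independently, by a field supported in the cone with apex \<open>z\<^sub>0\<close> spanned by the triangle.
  On a half with apex \<open>z\<^sub>0\<close> and edge directions \<open>a\<close>, \<open>b\<close> use the coordinates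
  \<open>x - z\<^sub>0 = \<lambda> a + \<mu> b\<close>.  A monomial \<open>\<lambda>\<^sup>i \<mu>\<^sup>j\<close> other than \<open>1\<close> is the divergence of
  \<open>\<lambda>\<^sup>i \<mu>\<^sup>j\<^sup>+\<^sup>1 b / (j + 1)\<close> if \<open>i > 0\<close>, and of \<open>\<lambda> \<mu>\<^sup>j a\<close> if \<open>i = 0\<close>; both fields vanish on the
  lines \<open>\<lambda> = 0\<close> and \<open>\<mu> = 0\<close>, so they extend by zero.  This leaves the values of the two
  polynomials at \<open>z\<^sub>0\<close>.  The piecewise linear hat function of the ray through \<open>z\<^sub>3\<^sub>+\<^sub>i\<close>, times a
  constant vector \<open>A\<close>, realises them both: the two conditions on \<open>A\<close> are independent because
  \<open>z\<^sub>i\<^sub>+\<^sub>1 - z\<^sub>0\<close> and \<open>z\<^sub>i\<^sub>+\<^sub>2 - z\<^sub>0\<close> are.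
\<close>

subsection \<open>Polynomials of bounded degree\<close>

lemma poly_deg_le_add:
  assumes "f \<in> poly_deg_le r" "g \<in> poly_deg_le r"
  shows "(\<lambda>x. f x + g x) \<in> poly_deg_le r"
proof -
  obtain c d where
    "f = (\<lambda>x. \<Sum>i\<le>r. \<Sum>j\<le>r - i. c i j * (x $ 1) ^ i * (x $ 2) ^ j)"
    "g = (\<lambda>x. \<Sum>i\<le>r. \<Sum>j\<le>r - i. d i j * (x $ 1) ^ i * (x $ 2) ^ j)"
    using assms unfolding poly_deg_le_def by blast
  then show ?thesis
    unfolding poly_deg_le_def
    by (auto intro!: exI[of _ "\<lambda>i j. c i j + d i j"] simp: sum.distrib ring_distribs)
qed

lemma poly_deg_le_cmult:
  assumes "f \<in> poly_deg_le r"
  shows "(\<lambda>x. a * f x) \<in> poly_deg_le r"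
proof -
  obtain c where "f = (\<lambda>x. \<Sum>i\<le>r. \<Sum>j\<le>r - i. c i j * (x $ 1) ^ i * (x $ 2) ^ j)"
    using assms unfolding poly_deg_le_def by blast
  then show ?thesis
    unfolding poly_deg_le_def
    by (auto intro!: exI[of _ "\<lambda>i j. a * c i j"] simp: sum_distrib_left mult.assoc)
qed

lemma poly_deg_le_monomial:
  assumes "i + j \<le> r"
  shows "(\<lambda>x. (x $ 1) ^ i * (x $ 2) ^ j) \<in> poly_deg_le r"
proof -
  have "(\<Sum>k\<le>r. \<Sum>l\<le>r - k. (if k = i \<and> l = j then 1 else 0) * (x $ 1) ^ k * (x $ 2) ^ l)
      = (x $ 1) ^ i * (x $ 2) ^ j" for x :: "real^2"
  proof -
    have "(\<Sum>l\<le>r - k. (if k = i \<and> l = j then 1 else 0) * (x $ 1) ^ k * (x $ 2) ^ l)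
      = (if k = i then (x $ 1) ^ i * (x $ 2) ^ j else 0)" for k
    proof (cases "k = i")
      case True
      have "(\<Sum>l\<le>r - i. (if l = j then 1 else 0) * (x $ 1) ^ i * (x $ 2) ^ l)
          = (\<Sum>l\<le>r - i. if l = j then (x $ 1) ^ i * (x $ 2) ^ l else 0)"
        by (rule sum.cong) auto
      then show ?thesis
        using True assms by simp
    qed simp
    then show ?thesis
      using assms by simp
  qed
  then show ?thesis
    unfolding poly_deg_le_def mem_Collect_eq
    by (intro exI[of _ "\<lambda>k l. if k = i \<and> l = j then 1 else 0"]) simp
qed

lemma poly_deg_le_const: "(\<lambda>x. a) \<in> poly_deg_le r"
  using poly_deg_le_cmult[OF poly_deg_le_monomial[of 0 0 r], of a] by simp

lemma poly_deg_le_coord: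
  "(\<lambda>x. x $ 1) \<in> poly_deg_le (Suc r)" "(\<lambda>x. x $ 2) \<in> poly_deg_le (Suc r)"
  using poly_deg_le_monomial[of 1 0 "Suc r"] poly_deg_le_monomial[of 0 1 "Suc r"] by simp_all

lemma poly_deg_le_sum:
  assumes "\<And>i. i \<in> I \<Longrightarrow> f i \<in> poly_deg_le r"
  shows "(\<lambda>x. \<Sum>i\<in>I. f i x) \<in> poly_deg_le r"
  using assms
  by (induction I rule: infinite_finite_induct) (auto intro: poly_deg_le_const poly_deg_le_add)

text \<open>Bilinearity reduces the claim to products of two monomials, whose exponents add.\<close>

lemma poly_deg_le_mult:
  assumes f: "f \<in> poly_deg_le m" and g: "g \<in> poly_deg_le n"
  shows "(\<lambda>x. f x * g x) \<in> poly_deg_le (m + n)"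
proof -
  \<comment> \<open>Used twice: first to expand \<open>g\<close> against a fixed monomial, then to
    expand \<open>f\<close> against \<open>g\<close>.\<close>
  have expand: "(\<lambda>x. h x * k x) \<in> poly_deg_le s"
    if h: "h \<in> poly_deg_le l"
      and k: "\<And>i j. i + j \<le> l \<Longrightarrow> (\<lambda>x. (x $ 1) ^ i * (x $ 2) ^ j * k x) \<in> poly_deg_le s"
    for h k l s
  proof -
    obtain c where "h = (\<lambda>x. \<Sum>i\<le>l. \<Sum>j\<le>l - i. c i j * (x $ 1) ^ i * (x $ 2) ^ j)"
      using h unfolding poly_deg_le_def by blast
    then have "(\<lambda>x. h x * k x)
      = (\<lambda>x. \<Sum>i\<le>l. \<Sum>j\<le>l - i. c i j * ((x $ 1) ^ i * (x $ 2) ^ j * k x))"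
      by (auto simp: sum_distrib_right mult.assoc)
    also have "\<dots> \<in> poly_deg_le s"
      by (intro poly_deg_le_sum poly_deg_le_cmult k) auto
    finally show ?thesis .
  qed
  have "(\<lambda>x. (x $ 1) ^ i * (x $ 2) ^ j * g x) \<in> poly_deg_le (m + n)" if "i + j \<le> m" for i j
  proof -
    have "(\<lambda>x. (x $ 1) ^ k * (x $ 2) ^ l * ((x $ 1) ^ i * (x $ 2) ^ j)) \<in> poly_deg_le (m + n)"
      if "k + l \<le> n" for k l
    proof -
      have "(\<lambda>x. (x $ 1) ^ (k + i) * (x $ 2) ^ (l + j)) \<in> poly_deg_le (m + n)"
        using that \<open>i + j \<le> m\<close> by (intro poly_deg_le_monomial) simp
      then show ?thesis by (simp add: power_add mult_ac)
    qed
    from expand[OF g this] show ?thesis by (simp add: mult.commute)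
  qed
  from expand[OF f this] show ?thesis .
qed

lemma poly_deg_le_power:
  assumes "f \<in> poly_deg_le 1"
  shows "(\<lambda>x. f x ^ n) \<in> poly_deg_le n"
proof (induction n)
  case 0
  then show ?case by (simp add: poly_deg_le_const)
next
  case (Suc n)
  from poly_deg_le_mult[OF assms Suc] show ?case by simp
qed

text \<open>The constant 1, read as a polynomial of degree at most \<open>n - m\<close>, serves as
  second factor; no coefficient sums have to be reindexed.\<close>

lemma poly_deg_le_mono:
  assumes "f \<in> poly_deg_le m" "m \<le> n"
  shows "f \<in> poly_deg_le n"
  using poly_deg_le_mult[OF assms(1) poly_deg_le_const[of 1 "n - m"]] assms(2) by simp

lemma poly_deg_le_power2:
  assumes "f \<in> poly_deg_le 1" "g \<in> poly_deg_le 1" "i + j \<le> r"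
  shows "(\<lambda>x. f x ^ i * g x ^ j) \<in> poly_deg_le r"
  using poly_deg_le_mult poly_deg_le_power assms poly_deg_le_mono by blast

lemma poly_deg_le_compose:
  assumes q: "q \<in> poly_deg_le r"
    and h: "(\<lambda>x. h x $ 1) \<in> poly_deg_le 1" "(\<lambda>x. h x $ 2) \<in> poly_deg_le 1"
  shows "(\<lambda>x. q (h x)) \<in> poly_deg_le r"
proof -
  obtain c where c: "q = (\<lambda>x. \<Sum>i\<le>r. \<Sum>j\<le>r - i. c i j * (x $ 1) ^ i * (x $ 2) ^ j)"
    using q unfolding poly_deg_le_def by blast
  have "(\<lambda>x. \<Sum>i\<le>r. \<Sum>j\<le>r - i. c i j * ((h x $ 1) ^ i * (h x $ 2) ^ j)) \<in> poly_deg_le r"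
    by (intro poly_deg_le_sum poly_deg_le_cmult poly_deg_le_power2 h) auto
  then show ?thesis by (simp add: c mult.assoc)
qed

lemma poly_deg_le_translate:
  assumes "q \<in> poly_deg_le r"
  shows "(\<lambda>x. q (x + a)) \<in> poly_deg_le r"
proof (rule poly_deg_le_compose[OF assms])
  have "(\<lambda>x. (x + a) $ k) \<in> poly_deg_le 1" if "(\<lambda>x. x $ k) \<in> poly_deg_le 1" for k
    using poly_deg_le_add[OF that poly_deg_le_const[of "a $ k"]] by simp
  then show "(\<lambda>x. (x + a) $ 1) \<in> poly_deg_le 1" "(\<lambda>x. (x + a) $ 2) \<in> poly_deg_le 1"
    using poly_deg_le_coord[of 0] by simp_all
qed

section \<open>Polynomial vector fields\<close>

definition poly_field :: "nat \<Rightarrow> (real^2 \<Rightarrow> real^2) set" where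
  "poly_field r = {v. \<forall>k. (\<lambda>x. v x $ k) \<in> poly_deg_le r}"

lemma poly_field_add:
  "\<lbrakk>v \<in> poly_field r; w \<in> poly_field r\<rbrakk> \<Longrightarrow> (\<lambda>x. v x + w x) \<in> poly_field r"
  by (auto simp: poly_field_def intro: poly_deg_le_add)

lemma poly_field_scaleR:
  assumes "f \<in> poly_deg_le r"
  shows "(\<lambda>x. f x *\<^sub>R a) \<in> poly_field r"
proof -
  have "(\<lambda>x. a $ k * f x) \<in> poly_deg_le r" for k
    by (rule poly_deg_le_cmult[OF assms])
  then show ?thesis by (simp add: poly_field_def mult.commute)
qed

lemma poly_field_translate:
  "v \<in> poly_field r \<Longrightarrow> (\<lambda>x. v (x + a)) \<in> poly_field r"
  by (auto simp: poly_field_def dest: poly_deg_le_translate)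

subsection \<open>Divergence\<close>

text \<open>The pointwise condition inside \<open>has_divergence_on\<close>, isolated so that it can
  be added, translated and localised.\<close>

definition has_div :: "(real^2 \<Rightarrow> real^2) \<Rightarrow> real \<Rightarrow> real^2 \<Rightarrow> bool" where
  "has_div v d x \<longleftrightarrow> (\<exists>D. (v has_derivative D) (at x) \<and> trace (matrix D) = d)"

lemma has_div_add:
  assumes "has_div v a x" "has_div w b x"
  shows "has_div (\<lambda>y. v y + w y) (a + b) x"
proof -
  obtain D E where "(v has_derivative D) (at x)" "trace (matrix D) = a"
      "(w has_derivative E) (at x)" "trace (matrix E) = b"
    using assms unfolding has_div_def by blast
  then show ?thesis
    unfolding has_div_def
    by (intro exI[of _ "\<lambda>h. D h + E h"]) (auto intro: has_derivative_add simp: trace_def matrix_def sum.distrib)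
qed

text \<open>The rank-one map \<open>\<lambda>h. L h *\<^sub>R a\<close> has trace
  \<open>L a\<close>. Up to sums and translations, every field constructed below is a scalar
  function times a constant vector, so its divergence is a directional derivative.\<close>

lemma has_div_scaleR:
  assumes "(f has_derivative L) (at x)"
  shows "has_div (\<lambda>y. f y *\<^sub>R a) (L a) x"
proof -
  have L: "linear L"
    using assms by (rule has_derivative_linear)
  have "trace (matrix (\<lambda>h. L h *\<^sub>R a)) = (\<Sum>i\<in>UNIV. a $ i * L (axis i 1))"
    by (simp add: trace_def matrix_def mult.commute)
  also have "\<dots> = L (\<Sum>i\<in>UNIV. a $ i *\<^sub>R axis i 1)"
    by (simp add: linear_sum[OF L] linear_cmul[OF L])
  also have "(\<Sum>i\<in>UNIV. a $ i *\<^sub>R axis i 1) = a"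
    using basis_expansion[of a] by (simp add: scalar_mult_eq_scaleR)
  finally show ?thesis
    unfolding has_div_def using has_derivative_scaleR_left[OF assms] by blast
qed

lemma has_div_translate:
  assumes "has_div v d (x - a)"
  shows "has_div (\<lambda>y. v (y - a)) d x"
proof -
  obtain D where D: "(v has_derivative D) (at (x - a))" "trace (matrix D) = d"
    using assms unfolding has_div_def by blast
  have "((\<lambda>y. y - a) has_derivative (\<lambda>h. h)) (at x)"
    by (auto intro!: derivative_eq_intros)
  from has_derivative_compose[OF this D(1)] D(2) show ?thesis
    unfolding has_div_def by auto
qed

lemma has_div_transform_open:
  assumes "has_div v d x" "open S" "x \<in> S" "\<And>y. y \<in> S \<Longrightarrow> v y = w y"
  shows "has_div w d x"
  using assms has_derivative_transform_within_open[of v _ x UNIV S w]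
  unfolding has_div_def by blast

subsection \<open>Solutions on a cone\<close>

definition cross2 :: "real^2 \<Rightarrow> real^2 \<Rightarrow> real" where
  "cross2 x y = x $ 1 * y $ 2 - x $ 2 * y $ 1"

lemma cross2_swap: "cross2 y x = - cross2 x y"
  by (simp add: cross2_def)

lemma cross2_0 [simp]: "cross2 x 0 = 0" "cross2 0 x = 0"
  by (simp_all add: cross2_def)

lemma cross2_self [simp]: "cross2 x x = 0"
  by (simp add: cross2_def)

lemma cross2_add: "cross2 (x + y) w = cross2 x w + cross2 y w" "cross2 w (x + y) = cross2 w x + cross2 w y"
  by (simp_all add: cross2_def algebra_simps)

lemma cross2_scaleR: "cross2 (c *\<^sub>R x) w = c * cross2 x w" "cross2 w (c *\<^sub>R x) = c * cross2 w x"
  by (simp_all add: cross2_def algebra_simps)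

lemma bounded_linear_cross2: "bounded_linear (\<lambda>x. cross2 x a)" "bounded_linear (cross2 a)"
  by (auto intro!: linear_conv_bounded_linear[THEN iffD1] linearI simp: cross2_add cross2_scaleR)

lemmas has_derivative_cross2 [derivative_intros] =
  bounded_linear.has_derivative[OF bounded_linear_cross2(1)]
  bounded_linear.has_derivative[OF bounded_linear_cross2(2)]

lemmas continuous_on_cross2 [continuous_intros] =
  bounded_linear.continuous_on[OF bounded_linear_cross2(1)]
  bounded_linear.continuous_on[OF bounded_linear_cross2(2)]

lemma poly_deg_le_cross2:
  "(\<lambda>x. cross2 x a) \<in> poly_deg_le (Suc r)" "cross2 a \<in> poly_deg_le (Suc r)"
proof -
  have "(\<lambda>x. s * x $ 1 + t * x $ 2) \<in> poly_deg_le (Suc r)" for s t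
    by (intro poly_deg_le_add poly_deg_le_cmult poly_deg_le_coord)
  from this[of "a $ 2" "- a $ 1"] this[of "- a $ 2" "a $ 1"]
  show "(\<lambda>x. cross2 x a) \<in> poly_deg_le (Suc r)" "cross2 a \<in> poly_deg_le (Suc r)"
    by (simp_all add: cross2_def[abs_def] algebra_simps)
qed

text \<open>The three-term Pluecker relation of four plane vectors. It decides which branch of the
  hat function is the smaller one, and shows that each half lies in the whole cone.\<close>

lemma cross2_plucker:
  "cross2 t m * cross2 x u = cross2 t x * cross2 m u + cross2 t u * cross2 x m"
  by (simp add: cross2_def algebra_simps)

text \<open>Cramer's rule: after division by \<open>cross2 a b\<close> the coefficients are the
  coordinates of \<open>x\<close> in the basis \<open>a\<close>, \<open>b\<close>.\<close>

lemma cross2_expand: "cross2 a b *\<^sub>R x = cross2 x b *\<^sub>R a + cross2 a x *\<^sub>R b"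
  by (simp add: cross2_def vec_eq_iff forall_2 algebra_simps)

text \<open>Vanishing on both lines permits a continuous extension by zero beyond the cone of
  \<open>a\<close> and \<open>b\<close>. Whole lines instead of rays are natural, since the fields
  used contain both linear coordinates as factors.\<close>

definition bubble_div :: "real^2 \<Rightarrow> real^2 \<Rightarrow> nat \<Rightarrow> (real^2 \<Rightarrow> real) \<Rightarrow> bool" where
  "bubble_div a b r q \<longleftrightarrow> (\<exists>V \<in> poly_field (Suc r). (\<forall>x. has_div V (q x) x) \<and>
     (\<forall>x. cross2 a x = 0 \<or> cross2 x b = 0 \<longrightarrow> V x = 0))"

lemma bubble_div_add:
  assumes "bubble_div a b r p" "bubble_div a b r q"
  shows "bubble_div a b r (\<lambda>x. p x + q x)"
proof -
  obtain V W where "V \<in> poly_field (Suc r)" "W \<in> poly_field (Suc r)"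
    "\<And>x. has_div V (p x) x" "\<And>x. has_div W (q x) x"
    "\<And>x. cross2 a x = 0 \<or> cross2 x b = 0 \<Longrightarrow> V x = 0"
    "\<And>x. cross2 a x = 0 \<or> cross2 x b = 0 \<Longrightarrow> W x = 0"
    using assms unfolding bubble_div_def by metis
  then show ?thesis
    unfolding bubble_div_def
    by (intro bexI[of _ "\<lambda>x. V x + W x"]) (auto intro: poly_field_add has_div_add)
qed

lemma bubble_div_scaleR:
  assumes "f \<in> poly_deg_le (Suc r)" "\<And>x. (f has_derivative L x) (at x)"
    and "\<And>x. cross2 a x = 0 \<or> cross2 x b = 0 \<Longrightarrow> f x = 0"
  shows "bubble_div a b r (\<lambda>x. L x d)"
  unfolding bubble_div_def using assms
  by (intro bexI[of _ "\<lambda>x. f x *\<^sub>R d"]) (auto intro: poly_field_scaleR has_div_scaleR)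

lemma bubble_div_0: "bubble_div a b r (\<lambda>x. 0)"
  using bubble_div_scaleR[of "\<lambda>x. 0" r "\<lambda>x h. 0" a b 0] by (simp add: poly_deg_le_const)

lemma bubble_div_sum:
  assumes "\<And>i. i \<in> I \<Longrightarrow> bubble_div a b r (f i)"
  shows "bubble_div a b r (\<lambda>x. \<Sum>i\<in>I. f i x)"
  using assms
  by (induction I rule: infinite_finite_induct) (auto intro: bubble_div_0 bubble_div_add)

text \<open>Along \<open>b\<close> only the second coordinate varies, so for \<open>i > 0\<close>
  the monomial is integrated in that direction. For \<open>i = 0\<close> this would lose the factor
  \<open>l\<close>, hence the integration goes along \<open>a\<close>.\<close>

lemma bubble_div_monomial:
  assumes ab: "cross2 a b \<noteq> 0" and ij: "i + j \<le> r" "i + j \<noteq> 0"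
  shows "bubble_div a b r
    (\<lambda>x. c * (cross2 x b / cross2 a b) ^ i * (cross2 a x / cross2 a b) ^ j)"
proof -
  define l where "l x = cross2 x b / cross2 a b" for x
  define m where "m x = cross2 a x / cross2 a b" for x
  have dl: "(l has_derivative l) (at x)" for x
    unfolding l_def[abs_def] by (auto intro!: derivative_eq_intros simp: ab)
  have dm: "(m has_derivative m) (at x)" for x
    unfolding m_def[abs_def] by (auto intro!: derivative_eq_intros simp: ab)
  have P: "l \<in> poly_deg_le 1" "m \<in> poly_deg_le 1"
    unfolding l_def[abs_def] m_def[abs_def]
    using poly_deg_le_cmult[OF poly_deg_le_cross2(1)[of b 0], of "inverse (cross2 a b)"]
      poly_deg_le_cmult[OF poly_deg_le_cross2(2)[of a 0], of "inverse (cross2 a b)"]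
    by (simp_all add: field_simps)
  \<comment> \<open>As \<open>l\<close> and \<open>m\<close> are linear, these are also their
    directional derivatives along \<open>a\<close> and \<open>b\<close>.\<close>
  have ends: "l a = 1" "m a = 0" "l b = 0" "m b = 1"
    using ab by (simp_all add: l_def m_def)
  have 0: "l x = 0" if "cross2 x b = 0" for x using that by (simp add: l_def)
  have 1: "m x = 0" if "cross2 a x = 0" for x using that by (simp add: m_def)
  have "bubble_div a b r (\<lambda>x. c * l x ^ i * m x ^ j)"
  proof (cases "i = 0")
    case True
    \<comment> \<open>Excluding the constant monomial leaves a factor \<open>m\<close>, so the field
      vanishes on the line \<open>m = 0\<close> too.\<close>
    then have j: "j \<noteq> 0" using ij by simp
    define L where "L x h = c * l h * m x ^ j + c * l x * (of_nat j * m h * m x ^ (j - 1))" for x h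
    have "bubble_div a b r (\<lambda>x. L x a)"
    proof (rule bubble_div_scaleR)
      show "((\<lambda>x. c * (l x ^ 1 * m x ^ j)) has_derivative L x) (at x)" for x
        unfolding L_def by (auto intro!: derivative_eq_intros dl dm simp: algebra_simps)
      show "(\<lambda>x. c * (l x ^ 1 * m x ^ j)) \<in> poly_deg_le (Suc r)"
        using ij True by (intro poly_deg_le_cmult poly_deg_le_power2 P) auto
    qed (use j 0 1 in auto)
    then show ?thesis by (simp add: L_def ends True)
  next
    case False
    \<comment> \<open>Cancels the factor produced by differentiating
      \<open>m x ^ Suc j\<close>.\<close>
    define k where "k = c / of_nat (Suc j)"
    define L where "L x h = k * (of_nat i * l h * l x ^ (i - 1)) * m x ^ Suc j
      + k * l x ^ i * (of_nat (Suc j) * m h * m x ^ j)" for x h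
    have "bubble_div a b r (\<lambda>x. L x b)"
    proof (rule bubble_div_scaleR)
      show "((\<lambda>x. k * (l x ^ i * m x ^ Suc j)) has_derivative L x) (at x)" for x
        unfolding L_def
        by (rule derivative_eq_intros dl dm | simp add: algebra_simps)+
      show "(\<lambda>x. k * (l x ^ i * m x ^ Suc j)) \<in> poly_deg_le (Suc r)"
        using ij by (intro poly_deg_le_cmult poly_deg_le_power2 P) auto
    qed (use False 0 1 in auto)
    moreover have "L x b = c * l x ^ i * m x ^ j" for x
      unfolding L_def ends by (simp add: k_def field_simps del: of_nat_Suc)
    ultimately show ?thesis by simp
  qed
  then show ?thesis by (simp add: l_def m_def)
qed

text \<open>Subtracting \<open>q 0\<close> removes precisely the constant monomial in the
  coordinates with respect to \<open>a\<close> and \<open>b\<close>; the others are covered by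
  \<open>bubble_div_monomial\<close>.\<close>

lemma bubble_div_poly:
  assumes ab: "cross2 a b \<noteq> 0" and q: "q \<in> poly_deg_le r"
  shows "bubble_div a b r (\<lambda>x. q x - q 0)"
proof -
  \<comment> \<open>The linear change of coordinates keeps the degree bound and yields coefficients
    \<open>c\<close> of \<open>q\<close> in the new coordinates.\<close>
  have "(\<lambda>y. (y $ 1 *\<^sub>R a + y $ 2 *\<^sub>R b) $ k) \<in> poly_deg_le 1" for k
    using poly_deg_le_add[OF poly_deg_le_cmult[OF poly_deg_le_coord(1)[of 0], of "a $ k"]
        poly_deg_le_cmult[OF poly_deg_le_coord(2)[of 0], of "b $ k"]]
    by (simp add: mult.commute)
  then have "(\<lambda>y. q (y $ 1 *\<^sub>R a + y $ 2 *\<^sub>R b)) \<in> poly_deg_le r"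
    by (intro poly_deg_le_compose[OF q])
  then obtain c where c: "\<And>y :: real^2. q (y $ 1 *\<^sub>R a + y $ 2 *\<^sub>R b)
      = (\<Sum>i\<le>r. \<Sum>j\<le>r - i. c i j * (y $ 1) ^ i * (y $ 2) ^ j)"
    unfolding poly_deg_le_def by blast
  have q_eq: "q x = (\<Sum>i\<le>r. \<Sum>j\<le>r - i.
      c i j * (cross2 x b / cross2 a b) ^ i * (cross2 a x / cross2 a b) ^ j)" for x
  proof -
    have "x = (1 / cross2 a b) *\<^sub>R (cross2 a b *\<^sub>R x)"
      using ab by simp
    also have "\<dots> = (cross2 x b / cross2 a b) *\<^sub>R a + (cross2 a x / cross2 a b) *\<^sub>R b"
      unfolding cross2_expand[of a b x] by (simp add: scaleR_add_right)
    finally show ?thesis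
      using c[of "vector [cross2 x b / cross2 a b, cross2 a x / cross2 a b]"] by simp
  qed
  \<comment> \<open>Writing \<open>q 0\<close> as the same double sum at the origin allows a
    termwise argument: the constant terms cancel, as \<open>0 ^ 0 = 1\<close>, and every other
    subtracted term is 0.\<close>
  have "bubble_div a b r (\<lambda>x. \<Sum>i\<le>r. \<Sum>j\<le>r - i.
      c i j * (cross2 x b / cross2 a b) ^ i * (cross2 a x / cross2 a b) ^ j
      - c i j * (cross2 0 b / cross2 a b) ^ i * (cross2 a 0 / cross2 a b) ^ j)"
  proof (intro bubble_div_sum)
    fix i j assume "i \<in> {..r}" "j \<in> {..r - i}"
    then have ij: "i + j \<le> r" by auto
    show "bubble_div a b r (\<lambda>x. 
      c i j * (cross2 x b / cross2 a b) ^ i * (cross2 a x / cross2 a b) ^ j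
      - c i j * (cross2 0 b / cross2 a b) ^ i * (cross2 a 0 / cross2 a b) ^ j)"
    proof (cases "i + j = 0")
      case True
      then show ?thesis by (simp add: bubble_div_0)
    next
      case False
      then have "c i j * (cross2 0 b / cross2 a b) ^ i * (cross2 a 0 / cross2 a b) ^ j = 0"
        by auto
      then show ?thesis
        using bubble_div_monomial[OF ab ij False, of "c i j"] by (simp only: diff_0_right)
    qed
  qed
  then show ?thesis
    by (simp only: sum_subtractf flip: q_eq)
qed

text \<open>Pasting over two closed sets that cover the space; on their overlap \<open>f\<close> or
  \<open>g\<close> is zero, so both branches are 0 there.\<close>

lemma continuous_on_extend_by_0:
  fixes V :: "'a::topological_space \<Rightarrow> 'b::real_normed_vector" and f g :: "'a \<Rightarrow> real"
  assumes V: "continuous_on UNIV V" and fg: "continuous_on UNIV f" "continuous_on UNIV g"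
    and 0: "\<And>x. f x = 0 \<or> g x = 0 \<Longrightarrow> V x = 0"
  shows "continuous_on UNIV (\<lambda>x. if 0 \<le> f x \<and> 0 \<le> g x then V x else 0)"
proof -
  have "closed {x. 0 \<le> f x \<and> 0 \<le> g x}" "closed {x. f x \<le> 0 \<or> g x \<le> 0}"
    by (intro closed_Collect_conj closed_Collect_disj closed_Collect_le fg continuous_on_const)+
  then have "continuous_on ({x. 0 \<le> f x \<and> 0 \<le> g x} \<union> {x. f x \<le> 0 \<or> g x \<le> 0})
      (\<lambda>x. if 0 \<le> f x \<and> 0 \<le> g x then V x else 0)"
    by (rule continuous_on_cases)
      (use 0 in \<open>force intro: continuous_on_subset[OF V] continuous_on_const\<close>)+
  moreover have "{x. 0 \<le> f x \<and> 0 \<le> g x} \<union> {x. f x \<le> 0 \<or> g x \<le> 0} = UNIV"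
    by force
  ultimately show ?thesis by simp
qed

lemma continuous_on_has_div:
  assumes "\<And>x. has_div V (d x) x"
  shows "continuous_on S V"
  by (rule continuous_at_imp_continuous_on)
    (use assms has_derivative_continuous in \<open>unfold has_div_def, blast\<close>)

text \<open>The apex is moved to the origin; \<open>t\<close>, \<open>m\<close>, \<open>u\<close>
  point to the first corner, the edge point and the second corner. \<open>w\<close> is the glued
  field. Its polynomial pieces \<open>V\<close> and \<open>W\<close> are recorded because they are
  differentiable everywhere, also on the rays where \<open>w\<close> may have a kink.\<close>

definition macro_solution :: "real^2 \<Rightarrow> real^2 \<Rightarrow> real^2 \<Rightarrow> nat \<Rightarrow> (real^2 \<Rightarrow> real) \<Rightarrow>
    (real^2 \<Rightarrow> real) \<Rightarrow> (real^2 \<Rightarrow> real^2) \<Rightarrow> (real^2 \<Rightarrow> real^2) \<Rightarrow> (real^2 \<Rightarrow> real^2) \<Rightarrow> bool"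
  where "macro_solution t m u r p q w V W \<longleftrightarrow>
    V \<in> poly_field (Suc r) \<and> W \<in> poly_field (Suc r) \<and> continuous_on UNIV w \<and>
    (\<forall>x. \<not> (0 < cross2 t x \<and> 0 < cross2 x u) \<longrightarrow> w x = 0) \<and>
    (\<forall>x. has_div V (p x) x) \<and> (\<forall>x. has_div W (q x) x) \<and>
    (\<forall>x. 0 \<le> cross2 t x \<and> 0 \<le> cross2 x m \<longrightarrow> w x = V x) \<and>
    (\<forall>x. 0 \<le> cross2 m x \<and> 0 \<le> cross2 x u \<longrightarrow> w x = W x)"

lemma macro_solution_exists:
  assumes tm: "0 < cross2 t m" and mu: "0 < cross2 m u" and tu: "0 < cross2 t u"
    and p: "p \<in> poly_deg_le r" and q: "q \<in> poly_deg_le r"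
  shows "\<exists>w V W. macro_solution t m u r p q w V W"
proof -
  obtain B where B: "B \<in> poly_field (Suc r)" "\<And>x. has_div B (p x - p 0) x"
      "\<And>x. cross2 t x = 0 \<or> cross2 x m = 0 \<Longrightarrow> B x = 0"
    using bubble_div_poly[OF _ p, of t m] tm unfolding bubble_div_def by fastforce
  obtain C where C: "C \<in> poly_field (Suc r)" "\<And>x. has_div C (q x - q 0) x"
      "\<And>x. cross2 m x = 0 \<or> cross2 x u = 0 \<Longrightarrow> C x = 0"
    using bubble_div_poly[OF _ q, of m u] mu unfolding bubble_div_def by fastforce
  \<comment> \<open>\<open>f\<close> vanishes along \<open>t\<close>, \<open>g\<close> along
    \<open>u\<close>, and both equal 1 at \<open>m\<close>; on the cone their minimum is the hat
    function.\<close>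
  define f where "f x = cross2 t x / cross2 t m" for x
  define g where "g x = cross2 x u / cross2 m u" for x
  \<comment> \<open>The solution of \<open>f A = p 0\<close>, \<open>g A = q 0\<close>. The system
    is diagonal in the basis \<open>t\<close>, \<open>u\<close>, because \<open>f t = 0\<close> and
    \<open>g u = 0\<close>.\<close>
  define A where "A = (q 0 * cross2 m u / cross2 t u) *\<^sub>R t + (p 0 * cross2 t m / cross2 t u) *\<^sub>R u"
  define w where "w x = (if 0 \<le> cross2 t x \<and> 0 \<le> cross2 x m then B x else 0)
    + (if 0 \<le> cross2 m x \<and> 0 \<le> cross2 x u then C x else 0)
    + max 0 (min (f x) (g x)) *\<^sub>R A" for x
  define V where "V x = B x + f x *\<^sub>R A" for x
  define W where "W x = C x + g x *\<^sub>R A" for x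
  have df: "(f has_derivative f) (at x)" and dg: "(g has_derivative g) (at x)" for x
    unfolding f_def[abs_def] g_def[abs_def] using tm mu by (auto intro!: derivative_eq_intros)
  have fA: "f A = p 0" and gA: "g A = q 0"
    using tm mu tu by (simp_all add: f_def g_def A_def cross2_add cross2_scaleR)
  \<comment> \<open>So the sign of \<open>g x - f x\<close> is that of \<open>cross2 x m\<close>:
    the minimum switches between \<open>f\<close> and \<open>g\<close> on the line through
    \<open>m\<close>.\<close>
  have gf: "(g x - f x) * (cross2 m u * cross2 t m) = cross2 t u * cross2 x m" for x
    using cross2_plucker[of t m x u] tm mu by (simp add: f_def g_def field_simps)
  have fg: "f x \<le> g x" if "0 \<le> cross2 x m" for x
  proof -
    have "0 \<le> (g x - f x) * (cross2 m u * cross2 t m)"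
      unfolding gf using that tu by simp
    moreover have "0 < cross2 m u * cross2 t m"
      using tm mu by simp
    ultimately show ?thesis by (simp add: zero_le_mult_iff)
  qed
  have gf': "g x \<le> f x" if "0 \<le> cross2 m x" for x
  proof -
    have "(g x - f x) * (cross2 m u * cross2 t m) \<le> 0"
      unfolding gf using that tu cross2_swap[of x m] by (simp add: mult_nonneg_nonpos)
    moreover have "0 < cross2 m u * cross2 t m"
      using tm mu by simp
    ultimately show ?thesis using tm mu by (auto simp: mult_le_0_iff)
  qed
  have sgn: "0 \<le> f x \<longleftrightarrow> 0 \<le> cross2 t x" "0 \<le> g x \<longleftrightarrow> 0 \<le> cross2 x u"
      "0 < f x \<longleftrightarrow> 0 < cross2 t x" "0 < g x \<longleftrightarrow> 0 < cross2 x u" for x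
    using tm mu by (simp_all add: f_def g_def field_simps)
  have P: "f \<in> poly_deg_le (Suc r)" "g \<in> poly_deg_le (Suc r)"
    unfolding f_def[abs_def] g_def[abs_def]
    using poly_deg_le_cmult[OF poly_deg_le_cross2(2)[of t r], of "inverse (cross2 t m)"]
      poly_deg_le_cmult[OF poly_deg_le_cross2(1)[of u r], of "inverse (cross2 m u)"]
    by (simp_all add: field_simps)
  have "V \<in> poly_field (Suc r)" "W \<in> poly_field (Suc r)"
    unfolding V_def[abs_def] W_def[abs_def] by (intro poly_field_add B C poly_field_scaleR P)+
  moreover have "continuous_on UNIV w"
    unfolding w_def[abs_def] f_def g_def
    using tm mu B(3) C(3)
    by (intro continuous_intros continuous_on_extend_by_0 continuous_on_has_div[OF B(2)]
        continuous_on_has_div[OF C(2)]) auto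
  moreover have "has_div V (p x) x" for x
    using has_div_add[OF B(2) has_div_scaleR[OF df, of A x]] unfolding V_def[abs_def] fA by simp
  moreover have "has_div W (q x) x" for x
    using has_div_add[OF C(2) has_div_scaleR[OF dg, of A x]] unfolding W_def[abs_def] gA by simp
  \<comment> \<open>The \<open>C\<close> summand is active here only if
    \<open>cross2 m x = 0\<close>, where it vanishes. The other half is symmetric.\<close>
  moreover have "w x = V x" if x: "0 \<le> cross2 t x" "0 \<le> cross2 x m" for x
    using x fg[OF x(2)] C(3)[of x] cross2_swap[of m x] sgn(1)[of x]
    by (auto simp: w_def V_def)
  moreover have "w x = W x" if x: "0 \<le> cross2 m x" "0 \<le> cross2 x u" for x
    using x gf'[OF x(1)] B(3)[of x] cross2_swap[of m x] sgn(2)[of x]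
    by (auto simp: w_def W_def)
  moreover have "w x = 0" if x: "\<not> (0 < cross2 t x \<and> 0 < cross2 x u)" for x
  proof -
    have hat: "min (f x) (g x) \<le> 0"
      using x sgn(3,4)[of x] by linarith
    \<comment> \<open>Off the line through \<open>t\<close> such a point would satisfy
      \<open>0 < f x \<le> g x\<close>, against \<open>hat\<close>.\<close>
    have "B x = 0" if "0 \<le> cross2 t x" "0 \<le> cross2 x m"
    proof (cases "cross2 t x = 0")
      case False
      then have "0 < f x" using that sgn(3) by simp
      then show ?thesis using fg[OF that(2)] hat by linarith
    qed (simp add: B(3))
    moreover have "C x = 0" if "0 \<le> cross2 m x" "0 \<le> cross2 x u"
    proof (cases "cross2 x u = 0")
      case False
      then have "0 < g x" using that sgn(4) by simp
      then show ?thesis using gf'[OF that(1)] hat by linarith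
    qed (simp add: C(3))
    ultimately show ?thesis using hat by (simp add: w_def)
  qed
  ultimately have "macro_solution t m u r p q w V W"
    unfolding macro_solution_def by blast
  then show ?thesis by blast
qed

subsection \<open>Geometry of the Powell--Sabin split\<close>

text \<open>Comparing \<open>k / s\<close> with \<open>j / (1 - s)\<close> tells on which side of
  the line through \<open>a\<close> and \<open>m\<close> the point lies; then \<open>c\<close> or
  \<open>b\<close> is eliminated in favour of \<open>m\<close>.\<close>

lemma convex_hull_3_subset_of_split:
  fixes a :: "'a::real_vector"
  assumes m: "m \<in> open_segment b c"
  shows "convex hull {a, b, c} \<subseteq> convex hull {a, b, m} \<union> convex hull {a, m, c}"
proof
  obtain s where s: "0 < s" "s < 1" "m = (1 - s) *\<^sub>R b + s *\<^sub>R c"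
    using m by (auto simp: in_segment)
  fix x assume "x \<in> convex hull {a, b, c}"
  then obtain i j k where x: "x = i *\<^sub>R a + j *\<^sub>R b + k *\<^sub>R c"
    and ijk: "0 \<le> i" "0 \<le> j" "0 \<le> k" "i + j + k = 1"
    unfolding convex_hull_3 by blast
  show "x \<in> convex hull {a, b, m} \<union> convex hull {a, m, c}"
  proof (cases "k * (1 - s) \<le> j * s")
    case True
    have "x = i *\<^sub>R a + (j - k * (1 - s) / s) *\<^sub>R b + (k / s) *\<^sub>R m"
      using s(1) by (simp add: x s(3) scaleR_add_right scaleR_diff_left[of j])
    moreover have "0 \<le> j - k * (1 - s) / s" "0 \<le> k / s"
      using True s ijk by (simp_all add: field_simps)
    moreover have "i + (j - k * (1 - s) / s) + k / s = 1"
    proof -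
      have "k / s - k * (1 - s) / s = k"
        using s by (simp add: field_simps)
      then show ?thesis using ijk by simp
    qed
    ultimately have "x \<in> convex hull {a, b, m}"
      unfolding convex_hull_3 using ijk(1) by blast
    then show ?thesis by simp
  next
    case False
    have "x = i *\<^sub>R a + (j / (1 - s)) *\<^sub>R m + (k - j * s / (1 - s)) *\<^sub>R c"
      using s(2) by (simp add: x s(3) scaleR_add_right scaleR_diff_left[of k])
    moreover have "0 \<le> k - j * s / (1 - s)" "0 \<le> j / (1 - s)"
      using False s ijk by (simp_all add: field_simps)
    moreover have "i + j / (1 - s) + (k - j * s / (1 - s)) = 1"
    proof -
      have "j / (1 - s) - j * s / (1 - s) = j * (1 - s) / (1 - s)"
        by (simp add: right_diff_distrib diff_divide_distrib)
      then show ?thesis using ijk s by simp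
    qed
    ultimately have "x \<in> convex hull {a, m, c}"
      unfolding convex_hull_3 using ijk(1) by blast
    then show ?thesis by simp
  qed
qed

text \<open>Solve the barycentric representation of \<open>z\<close> for \<open>c\<close> and
  substitute. The assumptions \<open>le\<close> keep the new coefficients of \<open>a\<close> and
  \<open>b\<close> nonnegative.\<close>

lemma convex_hull_3_exchange:
  fixes a b c :: "'a::real_vector"
  assumes z: "z = w1 *\<^sub>R a + w2 *\<^sub>R b + w3 *\<^sub>R c" "w1 + w2 + w3 = 1" "0 < w3"
    and x: "x = u1 *\<^sub>R a + u2 *\<^sub>R b + u3 *\<^sub>R c" "u1 + u2 + u3 = 1" "0 \<le> u3"
    and le: "u3 * w1 \<le> u1 * w3" "u3 * w2 \<le> u2 * w3"
  shows "x \<in> convex hull {z, a, b}"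
proof -
  let ?s = "u3 / w3"
  have "x = ?s *\<^sub>R z + (u1 - ?s * w1) *\<^sub>R a + (u2 - ?s * w2) *\<^sub>R b"
    using z(3) by (simp add: z(1) x(1) scaleR_add_right scaleR_diff_left flip: add_divide_distrib)
  moreover have "?s + (u1 - ?s * w1) + (u2 - ?s * w2) = 1"
  proof -
    have "?s + (u1 - ?s * w1) + (u2 - ?s * w2) = ?s * (1 - w1 - w2) + u1 + u2"
      by (simp add: right_diff_distrib)
    also have "1 - w1 - w2 = w3" using z(2) by simp
    finally show ?thesis using z(3) x(2) by simp
  qed
  moreover have "0 \<le> ?s" "0 \<le> u1 - ?s * w1" "0 \<le> u2 - ?s * w2"
    using z(3) x(3) le by (simp_all add: field_simps)
  ultimately show ?thesis
    unfolding convex_hull_3 by blast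
qed

text \<open>The vertex with the smallest ratio of the coordinate of \<open>x\<close> to that of
  \<open>z\<close> is exchanged for \<open>z\<close>.\<close>

lemma convex_hull_3_subset_of_star:
  fixes a b c :: "'a::real_vector"
  assumes z: "z = w1 *\<^sub>R a + w2 *\<^sub>R b + w3 *\<^sub>R c" "w1 + w2 + w3 = 1"
    and pos: "0 < w1" "0 < w2" "0 < w3"
  shows "convex hull {a, b, c} \<subseteq>
    convex hull {z, a, b} \<union> convex hull {z, b, c} \<union> convex hull {z, c, a}"
proof
  fix x assume "x \<in> convex hull {a, b, c}"
  then obtain u1 u2 u3 where x: "x = u1 *\<^sub>R a + u2 *\<^sub>R b + u3 *\<^sub>R c"
    and u: "0 \<le> u1" "0 \<le> u2" "0 \<le> u3" "u1 + u2 + u3 = 1"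
    unfolding convex_hull_3 by blast
  have z': "z = w2 *\<^sub>R b + w3 *\<^sub>R c + w1 *\<^sub>R a" "z = w3 *\<^sub>R c + w1 *\<^sub>R a + w2 *\<^sub>R b"
    "w2 + w3 + w1 = 1" "w3 + w1 + w2 = 1"
    using z by simp_all
  have x': "x = u2 *\<^sub>R b + u3 *\<^sub>R c + u1 *\<^sub>R a" "x = u3 *\<^sub>R c + u1 *\<^sub>R a + u2 *\<^sub>R b"
    "u2 + u3 + u1 = 1" "u3 + u1 + u2 = 1"
    using x u by simp_all
  consider "u1 / w1 \<le> u2 / w2" "u1 / w1 \<le> u3 / w3" | "u2 / w2 \<le> u1 / w1" "u2 / w2 \<le> u3 / w3"
    | "u3 / w3 \<le> u1 / w1" "u3 / w3 \<le> u2 / w2"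
    by linarith
  then show "x \<in> convex hull {z, a, b} \<union> convex hull {z, b, c} \<union> convex hull {z, c, a}"
  proof cases
    case 1
    then have "u1 * w2 \<le> u2 * w1" "u1 * w3 \<le> u3 * w1"
      using pos by (simp_all add: field_simps)
    from convex_hull_3_exchange[OF z'(1,3) pos(1) x'(1,3) u(1) this] show ?thesis by simp
  next
    case 2
    then have "u2 * w3 \<le> u3 * w2" "u2 * w1 \<le> u1 * w2"
      using pos by (simp_all add: field_simps)
    from convex_hull_3_exchange[OF z'(2,4) pos(2) x'(2,4) u(2) this] show ?thesis by simp
  next
    case 3
    then have "u3 * w1 \<le> u1 * w3" "u3 * w2 \<le> u2 * w3"
      using pos by (simp_all add: field_simps)
    from convex_hull_3_exchange[OF z(1,2) pos(3) x u(4,3) this] show ?thesis by simp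
  qed
qed

lemma cross2_convex_hull:
  assumes "x \<in> convex hull {o', a, b}" "0 < cross2 (a - o') (b - o')"
  shows "0 \<le> cross2 (a - o') (x - o')" "0 \<le> cross2 (x - o') (b - o')"
proof -
  obtain i j k where x: "x = i *\<^sub>R o' + j *\<^sub>R a + k *\<^sub>R b"
    and ijk: "0 \<le> i" "0 \<le> j" "0 \<le> k" "i + j + k = 1"
    using assms(1) unfolding convex_hull_3 by blast
  have i: "i = 1 - j - k" using ijk by simp
  have "x - o' = j *\<^sub>R (a - o') + k *\<^sub>R (b - o')"
    unfolding x i by (simp add: algebra_simps)
  then show "0 \<le> cross2 (a - o') (x - o')" "0 \<le> cross2 (x - o') (b - o')"
    using assms(2) ijk by (simp_all add: cross2_add cross2_scaleR)
qed

lemma negligible_cross2: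
  assumes "a \<noteq> 0"
  shows "negligible {x. cross2 a (x - o') = 0}"
proof -
  \<comment> \<open>The vector \<open>a\<close> rotated by a quarter turn, a normal of the
    line.\<close>
  define n :: "real^2" where "n = vector [- a $ 2, a $ 1]"
  have "n \<noteq> 0"
    using assms by (auto simp: n_def vec_eq_iff forall_2)
  moreover have "cross2 a (x - o') = 0 \<longleftrightarrow> n \<bullet> x = n \<bullet> o'" for x
    by (simp add: n_def cross2_def inner_vec_def sum_2) argo
  ultimately show ?thesis
    using negligible_hyperplane[of n "n \<bullet> o'"] by simp
qed

section \<open>Sign conditions and covering derived from \<open>powell_sabin\<close>\<close>

lemma mod_3_successors:
  "(1::nat) mod 3 + 1 = 2" "((1::nat) + 1) mod 3 + 1 = 3"
  "(2::nat) mod 3 + 1 = 3" "((2::nat) + 1) mod 3 + 1 = 1"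
  "(3::nat) mod 3 + 1 = 1" "((3::nat) + 1) mod 3 + 1 = 2"
  by simp_all

lemma powell_sabin_barycentric:
  assumes "powell_sabin z"
  obtains w1 w2 w3 where "z 0 = w1 *\<^sub>R z 1 + w2 *\<^sub>R z 2 + w3 *\<^sub>R z 3"
    "w1 + w2 + w3 = 1" "0 < w1" "0 < w2" "0 < w3"
proof -
  have D: "0 < cross2 (z 2 - z 1) (z 3 - z 1)"
    using assms by (simp add: powell_sabin_def cross2_def det_2)
  have "\<not> collinear {z 1, z 2, z 3}"
  proof
    assume "collinear {z 1, z 2, z 3}"
    then consider "z 1 = z 3" | c where "z 2 = c *\<^sub>R z 1 + (1 - c) *\<^sub>R z 3"
      by (auto simp: collinear_3_expand)
    then have "cross2 (z 2 - z 1) (z 3 - z 1) = 0"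
    proof cases
      case 2
      show ?thesis unfolding 2 cross2_def by (simp add: algebra_simps)
    qed simp
    then show False using D by simp
  qed
  then have "interior (convex hull {z 1, z 2, z 3}) = {v. \<exists>x y w. 0 < x \<and> 0 < y \<and> 0 < w \<and>
      x + y + w = 1 \<and> x *\<^sub>R z 1 + y *\<^sub>R z 2 + w *\<^sub>R z 3 = v}"
    by (rule interior_convex_hull_3_minimal) simp
  moreover have "z 0 \<in> interior (convex hull {z 1, z 2, z 3})"
    using assms by (simp add: powell_sabin_def ps_triangle_def)
  ultimately have "\<exists>x y w. 0 < x \<and> 0 < y \<and> 0 < w \<and>
      x + y + w = 1 \<and> x *\<^sub>R z 1 + y *\<^sub>R z 2 + w *\<^sub>R z 3 = z 0"
    by (simp only: mem_Collect_eq)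
  then show ?thesis
    using that by metis
qed

text \<open>Barycentric coordinates are area ratios: each cross product is a positive coordinate of
  \<open>z 0\<close> times that of the whole triangle.\<close>

lemma powell_sabin_macro_cross2:
  assumes ps: "powell_sabin z" and i: "i \<in> {1, 2, 3}"
  shows "0 < cross2 (z (i mod 3 + 1) - z 0) (z ((i + 1) mod 3 + 1) - z 0)"
proof -
  obtain w1 w2 w3 where z: "z 0 = w1 *\<^sub>R z 1 + w2 *\<^sub>R z 2 + w3 *\<^sub>R z 3"
    and w: "w1 + w2 + w3 = 1" "0 < w1" "0 < w2" "0 < w3"
    using powell_sabin_barycentric[OF ps] .
  have D: "0 < cross2 (z 2 - z 1) (z 3 - z 1)"
    using ps by (simp add: powell_sabin_def cross2_def det_2)
  have w1: "w1 = 1 - w2 - w3" using w by simp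
  have "cross2 (z 2 - z 0) (z 3 - z 0) = w1 * cross2 (z 2 - z 1) (z 3 - z 1)"
    "cross2 (z 3 - z 0) (z 1 - z 0) = w2 * cross2 (z 2 - z 1) (z 3 - z 1)"
    "cross2 (z 1 - z 0) (z 2 - z 0) = w3 * cross2 (z 2 - z 1) (z 3 - z 1)"
    unfolding z w1 cross2_def by (simp_all add: algebra_simps)
  then have "0 < cross2 (z 2 - z 0) (z 3 - z 0)" "0 < cross2 (z 3 - z 0) (z 1 - z 0)"
    "0 < cross2 (z 1 - z 0) (z 2 - z 0)"
    using D w by simp_all
  then show ?thesis
    using i by (elim insertE emptyE) (simp_all only: mod_3_successors)
qed

text \<open>The relative interior is the open segment once the endpoints differ; equal endpoints
  would make the cross product of \<open>powell_sabin_macro_cross2\<close> zero.\<close>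

lemma powell_sabin_edge_point:
  assumes ps: "powell_sabin z" and i: "i \<in> {1, 2, 3}"
  shows "z (3 + i) \<in> open_segment (z (i mod 3 + 1)) (z ((i + 1) mod 3 + 1))"
proof -
  have "z (i mod 3 + 1) \<noteq> z ((i + 1) mod 3 + 1)"
    using powell_sabin_macro_cross2[OF ps i] by auto
  moreover have "z (3 + i) \<in> rel_interior (ps_edge z i)"
    using ps i unfolding powell_sabin_def by blast
  ultimately show ?thesis
    by (simp add: ps_edge_def rel_interior_closed_segment)
qed

lemma powell_sabin_cross2:
  assumes ps: "powell_sabin z" and i: "i \<in> {1, 2, 3}"
  shows "0 < cross2 (z (i mod 3 + 1) - z 0) (z (3 + i) - z 0)"
    and "0 < cross2 (z (3 + i) - z 0) (z ((i + 1) mod 3 + 1) - z 0)"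
proof -
  let ?t = "z (i mod 3 + 1)" and ?u = "z ((i + 1) mod 3 + 1)"
  obtain s where s: "0 < s" "s < 1" "z (3 + i) = (1 - s) *\<^sub>R ?t + s *\<^sub>R ?u"
    using powell_sabin_edge_point[OF ps i] by (auto simp: in_segment)
  have "z (3 + i) - z 0 = (1 - s) *\<^sub>R (?t - z 0) + s *\<^sub>R (?u - z 0)"
    unfolding s(3) by (simp add: algebra_simps)
  then show "0 < cross2 (?t - z 0) (z (3 + i) - z 0)" "0 < cross2 (z (3 + i) - z 0) (?u - z 0)"
    using powell_sabin_macro_cross2[OF ps i] s by (simp_all add: cross2_add cross2_scaleR)
qed

lemma ps_triangle_subset_split:
  assumes ps: "powell_sabin z"
  shows "ps_triangle z \<subseteq> \<Union> (ps_split z)"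
proof -
  obtain w1 w2 w3 where z: "z 0 = w1 *\<^sub>R z 1 + w2 *\<^sub>R z 2 + w3 *\<^sub>R z 3"
    and w: "w1 + w2 + w3 = 1" "0 < w1" "0 < w2" "0 < w3"
    using powell_sabin_barycentric[OF ps] .
  have "convex hull {z 0, z (i mod 3 + 1), z ((i + 1) mod 3 + 1)} \<subseteq> \<Union> (ps_split z)"
    if "i \<in> {1, 2, 3}" for i :: nat
    using convex_hull_3_subset_of_split[OF powell_sabin_edge_point[OF ps that]] that
    unfolding ps_split_def by blast
  from this[of 1] this[of 2] this[of 3]
  have "convex hull {z 0, z 2, z 3} \<subseteq> \<Union> (ps_split z)"
    "convex hull {z 0, z 3, z 1} \<subseteq> \<Union> (ps_split z)"
    "convex hull {z 0, z 1, z 2} \<subseteq> \<Union> (ps_split z)"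
    unfolding mod_3_successors by blast+
  then show ?thesis
    using convex_hull_3_subset_of_star[OF z w] unfolding ps_triangle_def by blast
qed

text \<open>Any two of three cyclic indices are neighbours, so the cones share a corner ray, and the
  cross product with it has opposite signs on the two sides.\<close>

lemma powell_sabin_cones_disjoint:
  fixes i j :: nat
  assumes "i \<in> {1, 2, 3}" "j \<in> {1, 2, 3}" "i \<noteq> j"
    and "0 \<le> cross2 (z (i mod 3 + 1) - o') x"
      "0 \<le> cross2 x (z ((i + 1) mod 3 + 1) - o')"
  shows "\<not> (0 < cross2 (z (j mod 3 + 1) - o') x \<and> 0 < cross2 x (z ((j + 1) mod 3 + 1) - o'))"
proof -
  have "i mod 3 + 1 = (j + 1) mod 3 + 1 \<or> (i + 1) mod 3 + 1 = j mod 3 + 1"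
    using assms(1-3) by auto
  then show ?thesis
  proof
    assume eq: "i mod 3 + 1 = (j + 1) mod 3 + 1"
    show ?thesis
      using assms(4) cross2_swap[of x "z ((j + 1) mod 3 + 1) - o'"] unfolding eq by linarith
  next
    assume eq: "(i + 1) mod 3 + 1 = j mod 3 + 1"
    show ?thesis
      using assms(5) cross2_swap[of x "z (j mod 3 + 1) - o'"] unfolding eq by linarith
  qed
qed

subsection \<open>The divergence operator is surjective\<close>

lemma continuous_on_imp_square_integrable:
  assumes T: "compact T" and f: "continuous_on T f"
  shows "f \<in> square_integrable_on T"
proof -
  have "T \<in> sets lebesgue"
    using T by (simp add: borel_compact)
  moreover have "integrable lborel (\<lambda>x. indicator T x *\<^sub>R (f x)\<^sup>2)"
    by (intro borel_integrable_compact T continuous_intros f)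
  ultimately show ?thesis
    unfolding square_integrable_on_def
    by (simp add: continuous_imp_measurable_on_sets_lebesgue f integrable_restrict_space
        integrable_completion borel_measurable_integrable)
qed

lemma AE_lebesgue_on_iff:
  "compact S \<Longrightarrow> (AE x in lebesgue_on S. P x) \<longleftrightarrow> (AE x in lebesgue. x \<in> S \<longrightarrow> P x)"
  by (intro AE_restrict_space_iff) (simp add: borel_compact)

theorem corollary3p8:
  fixes z :: "nat \<Rightarrow> real^2" and r :: nat
  assumes "powell_sabin z"
  shows "\<forall>p \<in> pw_poly r z. \<exists>v \<in> lagrange_field (r + 1) z.
           has_divergence_on v p (ps_triangle z)"
proof
  fix p assume p: "p \<in> pw_poly r z"
  define I :: "nat set" where "I = {1, 2, 3}"
  define t where "t i = z (i mod 3 + 1)" for i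
  define m where "m i = z (3 + i)" for i
  define u where "u i = z ((i + 1) mod 3 + 1)" for i
  define o' where "o' = z 0"
  have finI: "finite I" by (simp add: I_def)
  have split: "ps_split z = (\<Union>i\<in>I. {convex hull {o', t i, m i}, convex hull {o', m i, u i}})"
    by (simp add: ps_split_def I_def t_def m_def u_def o'_def)
  have pos: "0 < cross2 (t i - o') (m i - o')" "0 < cross2 (m i - o') (u i - o')"
    "0 < cross2 (t i - o') (u i - o')" if "i \<in> I" for i
    using powell_sabin_cross2[OF assms] powell_sabin_macro_cross2[OF assms] that
    by (simp_all add: I_def t_def m_def u_def o'_def)
  have disj: "\<not> (0 < cross2 (t j - o') x \<and> 0 < cross2 x (u j - o'))"
    if "i \<in> I" "j \<in> I" "j \<noteq> i" "0 \<le> cross2 (t i - o') x" "0 \<le> cross2 x (u i - o')" for i j x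
    using powell_sabin_cones_disjoint[of i j z o' x] that by (simp add: I_def t_def u_def)
  have cover: "ps_triangle z \<subseteq> \<Union> (ps_split z)"
    by (rule ps_triangle_subset_split[OF assms])
  have "\<forall>S\<in>ps_split z. \<exists>g\<in>poly_deg_le r. AE x in lebesgue_on S. p x = g x"
    using p by (simp add: pw_poly_def)
  then obtain g where g: "\<And>S. S \<in> ps_split z \<Longrightarrow> g S \<in> poly_deg_le r"
      "\<And>S. S \<in> ps_split z \<Longrightarrow> AE x in lebesgue_on S. p x = g S x"
    by metis
  define K where "K i = convex hull {o', t i, m i}" for i
  define L where "L i = convex hull {o', m i, u i}" for i
  have KL: "K i \<in> ps_split z" "L i \<in> ps_split z" if "i \<in> I" for i
    using that by (auto simp: split K_def L_def)
  have split_cases: thesis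
    if "S \<in> ps_split z" "\<And>i. i \<in> I \<Longrightarrow> S = K i \<Longrightarrow> thesis" "\<And>i. i \<in> I \<Longrightarrow> S = L i \<Longrightarrow> thesis"
    for S thesis
    using that by (auto simp: split K_def L_def)
  have "\<exists>w V W. macro_solution (t i - o') (m i - o') (u i - o') r
      (\<lambda>x. g (K i) (x + o')) (\<lambda>x. g (L i) (x + o')) w V W" if "i \<in> I" for i
    using that by (intro macro_solution_exists pos poly_deg_le_translate g KL)
  then obtain w V W where sol: "\<And>i. i \<in> I \<Longrightarrow> macro_solution (t i - o') (m i - o') (u i - o') r
      (\<lambda>x. g (K i) (x + o')) (\<lambda>x. g (L i) (x + o')) (w i) (V i) (W i)"
    by metis
  then have VW: "V i \<in> poly_field (Suc r)" "W i \<in> poly_field (Suc r)"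
    and w: "continuous_on UNIV (w i)"
    and w0: "\<not> (0 < cross2 (t i - o') x \<and> 0 < cross2 x (u i - o')) \<Longrightarrow> w i x = 0"
    and div: "has_div (V i) (g (K i) (x + o')) x" "has_div (W i) (g (L i) (x + o')) x"
    and wV: "0 \<le> cross2 (t i - o') x \<Longrightarrow> 0 \<le> cross2 x (m i - o') \<Longrightarrow> w i x = V i x"
    and wW: "0 \<le> cross2 (m i - o') x \<Longrightarrow> 0 \<le> cross2 x (u i - o') \<Longrightarrow> w i x = W i x"
    if "i \<in> I" for i x
    using that unfolding macro_solution_def by blast+
  \<comment> \<open>Each summand is supported in its own cone, so on the closed cone of
    \<open>i\<close> only \<open>w i\<close> survives.\<close>
  define v where "v x = (\<Sum>i\<in>I. w i (x - o'))" for x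
  have v_cont: "continuous_on S v" for S
    unfolding v_def[abs_def]
    by (intro continuous_on_sum continuous_on_compose2[OF w] continuous_intros) auto
  have v_w: "v x = w i (x - o')"
    if i: "i \<in> I" and x: "0 \<le> cross2 (t i - o') (x - o')" "0 \<le> cross2 (x - o') (u i - o')" for x i
  proof -
    have "(\<Sum>j\<in>I - {i}. w j (x - o')) = 0"
      using i x disj by (intro sum.neutral ballI w0) auto
    then show ?thesis
      unfolding v_def using sum.remove[OF finI i, of "\<lambda>i. w i (x - o')"] by simp
  qed
  have vK: "v x = V i (x - o')"
    if i: "i \<in> I" and x: "0 \<le> cross2 (t i - o') (x - o')" "0 \<le> cross2 (x - o') (m i - o')" for x i
  proof -
    \<comment> \<open>The Pluecker relation places the half between \<open>t i\<close> and
      \<open>m i\<close> inside the whole cone, so \<open>v_w\<close> applies.\<close>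
    have "0 \<le> cross2 (t i - o') (m i - o') * cross2 (x - o') (u i - o')"
      unfolding cross2_plucker[of "t i - o'" "m i - o'" "x - o'" "u i - o'"]
      using x pos[OF i] by simp
    then have "0 \<le> cross2 (x - o') (u i - o')"
      using pos(1)[OF i] by (simp add: zero_le_mult_iff)
    then show ?thesis
      using v_w[OF i x(1)] wV[OF i x] by simp
  qed
  have vL: "v x = W i (x - o')"
    if i: "i \<in> I" and x: "0 \<le> cross2 (m i - o') (x - o')" "0 \<le> cross2 (x - o') (u i - o')" for x i
  proof -
    have "cross2 (t i - o') (x - o') * cross2 (m i - o') (u i - o')
        = cross2 (t i - o') (m i - o') * cross2 (x - o') (u i - o')
        + cross2 (t i - o') (u i - o') * cross2 (m i - o') (x - o')"
      using cross2_plucker[of "t i - o'" "m i - o'" "x - o'" "u i - o'"]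
        cross2_swap[of "m i - o'" "x - o'"] by simp
    also have "0 \<le> \<dots>"
      using x pos[OF i] by simp
    finally have "0 \<le> cross2 (t i - o') (x - o')"
      using pos(2)[OF i] by (simp add: zero_le_mult_iff)
    then show ?thesis
      using v_w[OF i _ x(2)] wW[OF i x] by simp
  qed
  have v_poly: "\<exists>Q\<in>poly_field (Suc r). \<forall>x\<in>S. v x = Q x" if "S \<in> ps_split z" for S
    using that
  proof (rule split_cases)
    fix i assume i: "i \<in> I" "S = K i"
    then have "v x = V i (x - o')" if "x \<in> S" for x
      using that cross2_convex_hull[of x o' "t i" "m i"] pos[OF i(1)]
      by (intro vK) (auto simp: K_def)
    then show ?thesis
      using poly_field_translate[OF VW(1)[OF i(1)], of "- o'"]
      by (intro bexI[of _ "\<lambda>x. V i (x - o')"]) auto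
  next
    fix i assume i: "i \<in> I" "S = L i"
    then have "v x = W i (x - o')" if "x \<in> S" for x
      using that cross2_convex_hull[of x o' "m i" "u i"] pos[OF i(1)]
      by (intro vL) (auto simp: L_def)
    then show ?thesis
      using poly_field_translate[OF VW(2)[OF i(1)], of "- o'"]
      by (intro bexI[of _ "\<lambda>x. W i (x - o')"]) auto
  qed
  have compact_split: "compact S" if "S \<in> ps_split z" for S
    using that by (auto simp: split intro: finite_imp_compact_convex_hull)
  have compact_T: "compact (ps_triangle z)"
    by (auto simp: ps_triangle_def intro: finite_imp_compact_convex_hull)
  have v_comp_cont: "continuous_on S (\<lambda>x. v x $ k)" for S k
    by (intro continuous_intros v_cont)
  have "v \<in> lagrange_field (r + 1) z"
    unfolding lagrange_field_def pw_poly_def mem_Collect_eq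
  proof (intro allI conjI ballI v_comp_cont continuous_on_imp_square_integrable compact_T)
    fix k S assume "S \<in> ps_split z"
    then obtain Q where "Q \<in> poly_field (Suc r)" "\<And>x. x \<in> S \<Longrightarrow> v x = Q x"
      using v_poly by blast
    then show "\<exists>g\<in>poly_deg_le (r + 1). AE x in lebesgue_on S. v x $ k = g x"
      by (intro bexI[of _ "\<lambda>x. Q x $ k"] AE_I2) (auto simp: poly_field_def)
  qed
  moreover have "has_divergence_on v p (ps_triangle z)"
  proof -
    \<comment> \<open>The lines through \<open>z 0\<close> that carry the interior edges. Off this
      null set, a point of a piece lies in the open cone of that piece, where \<open>v\<close>
      equals one translated polynomial field. That cone continues past the outer edge, so it is a
      full neighbourhood even of points on the boundary of the triangle.\<close>
    define N where "N = (\<Union>i\<in>I. \<Union>a\<in>{t i, m i, u i}. {x. cross2 (a - o') (x - o') = 0})"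
    have "negligible {x. cross2 (a - o') (x - o') = 0}" if "i \<in> I" "a \<in> {t i, m i, u i}" for i a
      using that pos[of i] by (intro negligible_cross2) auto
    then have "negligible N"
      unfolding N_def using finI by (intro negligible_Union) (auto intro!: negligible_Union)
    then have "AE x in lebesgue. x \<notin> N"
      by (simp add: negligible_iff_null_sets AE_not_in)
    moreover have "AE x in lebesgue. \<forall>S\<in>ps_split z. x \<in> S \<longrightarrow> p x = g S x"
    proof (rule AE_finite_allI)
      show "finite (ps_split z)" by (simp add: split finI)
      show "AE x in lebesgue. x \<in> S \<longrightarrow> p x = g S x" if "S \<in> ps_split z" for S
        using g(2)[OF that] unfolding AE_lebesgue_on_iff[OF compact_split[OF that]] .
    qed
    ultimately have "AE x in lebesgue. x \<in> ps_triangle z \<longrightarrow> has_div v (p x) x"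
    proof eventually_elim
      case (elim x)
      show ?case
      proof
        assume "x \<in> ps_triangle z"
        then obtain S where S: "S \<in> ps_split z" "x \<in> S"
          using cover by blast
        then have px: "p x = g S x" using elim by blast
        have open_cone: "open {y. 0 < cross2 a (y - o') \<and> 0 < cross2 (y - o') b}" for a b
          by (intro open_Collect_conj open_Collect_less continuous_intros)
        from S(1) show "has_div v (p x) x"
        proof (rule split_cases)
          fix i assume i: "i \<in> I" "S = K i"
          have "x \<in> {y. 0 < cross2 (t i - o') (y - o') \<and> 0 < cross2 (y - o') (m i - o')}"
            using cross2_convex_hull[of x o' "t i" "m i"] pos[OF i(1)] S(2) i elim(1)
              cross2_swap[of "x - o'" "m i - o'"]
            by (auto simp: K_def N_def less_le)
          moreover have "has_div (\<lambda>y. V i (y - o')) (p x) x"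
            using div(1)[OF i(1), of "x - o'"] i(2) px by (intro has_div_translate) simp
          ultimately show ?thesis
            by - (erule has_div_transform_open[OF _ open_cone], assumption, simp add: vK[OF i(1)])
        next
          fix i assume i: "i \<in> I" "S = L i"
          have "x \<in> {y. 0 < cross2 (m i - o') (y - o') \<and> 0 < cross2 (y - o') (u i - o')}"
            using cross2_convex_hull[of x o' "m i" "u i"] pos[OF i(1)] S(2) i elim(1)
              cross2_swap[of "x - o'" "u i - o'"]
            by (auto simp: L_def N_def less_le)
          moreover have "has_div (\<lambda>y. W i (y - o')) (p x) x"
            using div(2)[OF i(1), of "x - o'"] i(2) px by (intro has_div_translate) simp
          ultimately show ?thesis
            by - (erule has_div_transform_open[OF _ open_cone], assumption, simp add: vL[OF i(1)])
        qed
      qed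
    qed
    then show ?thesis
      unfolding has_divergence_on_def AE_lebesgue_on_iff[OF compact_T] has_div_def .
  qed
  ultimately show "\<exists>v \<in> lagrange_field (r + 1) z. has_divergence_on v p (ps_triangle z)"
    by blast
qed

end
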